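(* Let $(X,d)$ be a nonempty pseudometric space. Then the following conditions are equivalent: (i) $d\colon X^2\to\mathbb{R}$ is discrete. (ii) If $Q$ is the partition of $X$ corresponding to $\sim_d$, then $Q\otimes_2 Q=P_{d^{-1}}$. (iii) There is a partition $Q$ of $X$ such that $Q\otimes_2 Q=P_{d^{-1}}$.
   Context: A pseudometric on a set $X$ is a function $d\colon X^2\to\mathbb{R}$ that is non-negative, symmetric, satisfies $d(x,x)=0$ for all $x$, and satisfies the triangle inequality. The relation $x\sim_d y :\Leftrightarrow d(x,y)=0$ is an equivalence relation on $X$; the partition corresponding to it is the set of its equivalence classes. Write $d(X^2)=\{d(x,y):x,y\in X\}$ and $P_{d^{-1}}:=\{d^{-1}(t): t\in d(X^2)\}$, where $d^{-1}(t)=\{\langle x,y\rangle\in X^2: d(x,y)=t\}$. A metric subspace of $(X,d)$ is a subset $Y\subseteq X$ such that $d|_{Y^2}$ is a metric. A metric $d$ on a set $Y$ is discrete if $|d(Y^2)|\le 2$. A pseudometric $d$ on $X$ is discrete if all metric subspaces of $(X,d)$ are discrete (equivalently, $|d(X^2)|\le 2$). For a partition $Q=\{X_j:j\in J\}$ of $X$ (with different indices giving different blocks), the partition $Q\otimes_2 Q$ of $X^2$ is defined as follows: if $|J|=1$, then $Q\otimes_2 Q=\{X^2\}$; otherwise its blocks are exactly $\bigcup_{j\in J}X_j^2$ and $X^2\setminus\bigcup_{j\in J}X_j^2$. *)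

theory Defs
  imports Complex_Main "HOL-Library.Disjoint_Sets"
begin

text \<open>
  All notions are relative to the carrier: nothing is assumed about \<open>d\<close> outside it. The locale
  \<open>Metric_space\<close> of HOL-Analysis is not used since it requires non-negativity and symmetry of
  \<open>d\<close> on the whole type.
\<close>

definition pseudometric_on :: "'a set \<Rightarrow> ('a \<Rightarrow> 'a \<Rightarrow> real) \<Rightarrow> bool" where
  "pseudometric_on X d \<longleftrightarrow>
     (\<forall>x\<in>X. \<forall>y\<in>X. 0 \<le> d x y) \<and>
     (\<forall>x\<in>X. \<forall>y\<in>X. d x y = d y x) \<and>
     (\<forall>x\<in>X. d x x = 0) \<and>
     (\<forall>x\<in>X. \<forall>y\<in>X. \<forall>z\<in>X. d x z \<le> d x y + d y z)"

definition metric_on :: "'a set \<Rightarrow> ('a \<Rightarrow> 'a \<Rightarrow> real) \<Rightarrow> bool" where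
  "metric_on X d \<longleftrightarrow>
     pseudometric_on X d \<and> (\<forall>x\<in>X. \<forall>y\<in>X. d x y = 0 \<longrightarrow> x = y)"

definition dist_values :: "'a set \<Rightarrow> ('a \<Rightarrow> 'a \<Rightarrow> real) \<Rightarrow> real set" where
  "dist_values X d = {d x y | x y. x \<in> X \<and> y \<in> X}"

text \<open>Finiteness is explicit because \<open>card\<close> of an infinite set is \<open>0\<close>.\<close>

definition discrete_metric_on :: "'a set \<Rightarrow> ('a \<Rightarrow> 'a \<Rightarrow> real) \<Rightarrow> bool" where
  "discrete_metric_on Y d \<longleftrightarrow>
     metric_on Y d \<and> finite (dist_values Y d) \<and> card (dist_values Y d) \<le> 2"

definition discrete_pseudometric_on :: "'a set \<Rightarrow> ('a \<Rightarrow> 'a \<Rightarrow> real) \<Rightarrow> bool" where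
  "discrete_pseudometric_on X d \<longleftrightarrow>
     pseudometric_on X d \<and> (\<forall>Y. Y \<subseteq> X \<and> metric_on Y d \<longrightarrow> discrete_metric_on Y d)"

definition zero_dist_rel :: "'a set \<Rightarrow> ('a \<Rightarrow> 'a \<Rightarrow> real) \<Rightarrow> ('a \<times> 'a) set" where
  "zero_dist_rel X d = {(x, y). x \<in> X \<and> y \<in> X \<and> d x y = 0}"

definition dist_fibres :: "'a set \<Rightarrow> ('a \<Rightarrow> 'a \<Rightarrow> real) \<Rightarrow> ('a \<times> 'a) set set" where
  "dist_fibres X d = (\<lambda>t. {(x, y). x \<in> X \<and> y \<in> X \<and> d x y = t}) ` dist_values X d"

text \<open>
  \<open>Q \<otimes>\<^sub>2 Q\<close> for a partition \<open>Q\<close> of \<open>X\<close>. The second case is meant for at least two blocks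
  (possibly infinitely many); \<open>Q = {}\<close> only arises for \<open>X = {}\<close>.
\<close>

definition partition_otimes2 :: "'a set \<Rightarrow> 'a set set \<Rightarrow> ('a \<times> 'a) set set" where
  "partition_otimes2 X Q =
     (if card Q = 1 then {X \<times> X}
      else {\<Union>A\<in>Q. A \<times> A, X \<times> X - (\<Union>A\<in>Q. A \<times> A)})"

end

theory Submission
  imports Defs
begin

text \<open>
  A set of representatives of the classes of \<open>\<sim>\<^sub>d\<close> is a metric subspace on which \<open>d\<close> takes
  all its values, so \<open>d\<close> is discrete iff it takes at most two values. Since \<open>t \<mapsto> d\<^sup>-\<^sup>1(t)\<close> is
  injective on the values of \<open>d\<close>, that holds iff \<open>P\<^bsub>d\<^sup>-\<^sup>1\<^esub>\<close> has at most two members, and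
  \<open>Q \<otimes>\<^sub>2 Q\<close> never has more than two. Conversely, if \<open>d\<close> takes only the values \<open>0\<close> and \<open>t\<close>, then the
  fibre of \<open>0\<close> is \<open>\<sim>\<^sub>d\<close>, which is the union of the squares of its classes.
\<close>

lemma dist_values_mono: "Y \<subseteq> X \<Longrightarrow> dist_values Y d \<subseteq> dist_values X d"
  unfolding dist_values_def by blast

lemma zero_in_dist_values:
  assumes "X \<noteq> {}" "pseudometric_on X d"
  shows "0 \<in> dist_values X d"
proof -
  obtain x where "x \<in> X" using assms(1) by blast
  then have "d x x = 0" using assms(2) by (simp add: pseudometric_on_def)
  then show ?thesis
    using \<open>x \<in> X\<close> unfolding dist_values_def by force
qed

lemma equiv_zero_dist_rel:
  assumes "pseudometric_on X d"
  shows "equiv X (zero_dist_rel X d)"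
proof (rule equivI)
  show "zero_dist_rel X d \<subseteq> X \<times> X"
    by (auto simp: zero_dist_rel_def)
  show "refl_on X (zero_dist_rel X d)"
    using assms by (auto simp: refl_on_def zero_dist_rel_def pseudometric_on_def)
  show "sym (zero_dist_rel X d)"
    using assms by (auto simp: sym_def zero_dist_rel_def pseudometric_on_def)
  show "trans (zero_dist_rel X d)"
  proof (rule transI)
    fix x y z
    assume "(x, y) \<in> zero_dist_rel X d" "(y, z) \<in> zero_dist_rel X d"
    then have *: "x \<in> X" "y \<in> X" "z \<in> X" "d x y = 0" "d y z = 0"
      by (auto simp: zero_dist_rel_def)
    have "d x z \<le> d x y + d y z" "0 \<le> d x z"
      using assms * unfolding pseudometric_on_def by blast+
    with * show "(x, z) \<in> zero_dist_rel X d"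
      by (simp add: zero_dist_rel_def)
  qed
qed

text \<open>Detours through points at distance zero cost nothing, so two triangle inequalities in
  each direction give equality. Hence \<open>d\<close> depends only on the classes of its
  arguments.\<close>

lemma dist_cong_zero:
  assumes "pseudometric_on X d" "x \<in> X" "x' \<in> X" "y \<in> X" "y' \<in> X"
    and "d x x' = 0" "d y y' = 0"
  shows "d x y = d x' y'"
proof -
  have sym: "d a b = d b a" and tri: "d a c \<le> d a b + d b c"
    if "a \<in> X" "b \<in> X" "c \<in> X" for a b c
    using assms(1) that unfolding pseudometric_on_def by blast+
  have "d x y \<le> d x x' + d x' y" "d x' y \<le> d x' y' + d y' y"
    "d x' y' \<le> d x' x + d x y'" "d x y' \<le> d x y + d y y'"
    "d x' x = d x x'" "d y' y = d y y'"
    using sym tri assms(2-5) by blast+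
  then show ?thesis using assms(6,7) by linarith
qed

lemma exists_metric_subspace_same_dist_values:
  assumes "pseudometric_on X d"
  obtains Y where "Y \<subseteq> X" "metric_on Y d" "dist_values Y d = dist_values X d"
proof -
  \<comment> \<open>The choice predicate depends on \<open>x\<close> only through its class, so
    equivalent points get the same representative.\<close>
  define f where "f x = (SOME y. (x, y) \<in> zero_dist_rel X d)" for x
  note eqv = equiv_zero_dist_rel[OF assms]
  have f: "(x, f x) \<in> zero_dist_rel X d" if "x \<in> X" for x
  proof -
    have "(x, x) \<in> zero_dist_rel X d"
      using eqv that by (meson equiv_def refl_onD)
    then show ?thesis unfolding f_def by (rule someI)
  qed
  then have fX: "f x \<in> X" and f0: "d x (f x) = 0" if "x \<in> X" for x
    using that by (auto simp: zero_dist_rel_def)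
  have sub: "f ` X \<subseteq> X" using fX by blast
  have "f x = f y" if "x \<in> X" "y \<in> X" "d (f x) (f y) = 0" for x y
  proof -
    have "d x y = 0"
      using dist_cong_zero[OF assms that(1) fX[OF that(1)] that(2) fX[OF that(2)]] f0 that by simp
    then have "(x, y) \<in> zero_dist_rel X d"
      using that by (simp add: zero_dist_rel_def)
    then have "(x, z) \<in> zero_dist_rel X d \<longleftrightarrow> (y, z) \<in> zero_dist_rel X d" for z
      using equiv_class_eq[OF eqv] by blast
    then show ?thesis by (simp add: f_def)
  qed
  moreover have "pseudometric_on (f ` X) d"
    using assms sub by (simp add: pseudometric_on_def subset_iff)
  ultimately have "metric_on (f ` X) d"
    unfolding metric_on_def by blast
  moreover have "dist_values X d \<subseteq> dist_values (f ` X) d"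
  proof
    fix t assume "t \<in> dist_values X d"
    then obtain x y where xy: "x \<in> X" "y \<in> X" "t = d x y"
      by (auto simp: dist_values_def)
    then have "t = d (f x) (f y)"
      using dist_cong_zero[OF assms xy(1) fX[OF xy(1)] xy(2) fX[OF xy(2)]] f0 by simp
    then show "t \<in> dist_values (f ` X) d"
      using xy unfolding dist_values_def by blast
  qed
  ultimately show thesis
    using that[OF sub] dist_values_mono[OF sub] by blast
qed

text \<open>Replaces the quantifier over all metric subspaces by a count on \<open>X\<close>: the
  subspace of representatives attains every value, and no subset attains more.\<close>

lemma discrete_pseudometric_on_iff_card:
  assumes "pseudometric_on X d"
  shows "discrete_pseudometric_on X d \<longleftrightarrow>
           finite (dist_values X d) \<and> card (dist_values X d) \<le> 2"
proof
  assume "discrete_pseudometric_on X d"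
  moreover obtain Y where "Y \<subseteq> X" "metric_on Y d" "dist_values Y d = dist_values X d"
    using exists_metric_subspace_same_dist_values[OF assms] .
  ultimately show "finite (dist_values X d) \<and> card (dist_values X d) \<le> 2"
    unfolding discrete_pseudometric_on_def discrete_metric_on_def by auto
next
  assume "finite (dist_values X d) \<and> card (dist_values X d) \<le> 2"
  then show "discrete_pseudometric_on X d"
    using assms unfolding discrete_pseudometric_on_def discrete_metric_on_def
    by (meson card_mono dist_values_mono finite_subset le_trans)
qed

text \<open>Every value is attained, so its fibre is nonempty and any pair in the fibre recovers the
  value.\<close>

lemma inj_on_dist_fibre:
  "inj_on (\<lambda>t. {(x, y). x \<in> X \<and> y \<in> X \<and> d x y = t}) (dist_values X d)"
  by (rule inj_onI) (auto simp: dist_values_def)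

lemma finite_dist_fibres_iff: "finite (dist_fibres X d) \<longleftrightarrow> finite (dist_values X d)"
  unfolding dist_fibres_def by (rule finite_image_iff[OF inj_on_dist_fibre])

lemma card_dist_fibres: "card (dist_fibres X d) = card (dist_values X d)"
  unfolding dist_fibres_def by (rule card_image[OF inj_on_dist_fibre])

lemma finite_partition_otimes2: "finite (partition_otimes2 X Q)"
  by (simp add: partition_otimes2_def)

lemma card_partition_otimes2_le: "card (partition_otimes2 X Q) \<le> 2"
  by (simp add: partition_otimes2_def card_insert_if)

text \<open>Two points lie in a common class iff they are related. For
  \<open>zero_dist_rel X d\<close> this identifies the union of squares in
  \<open>partition_otimes2\<close> with the fibre of 0.\<close>

lemma Union_squares_quotient:
  assumes "equiv X r"
  shows "(\<Union>A\<in>X // r. A \<times> A) = r"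
proof
  show "(\<Union>A\<in>X // r. A \<times> A) \<subseteq> r"
    using quotient_eq_iff[OF assms] by fastforce
  show "r \<subseteq> (\<Union>A\<in>X // r. A \<times> A)"
  proof clarify
    fix x y assume "(x, y) \<in> r"
    then have "x \<in> X" "x \<in> r `` {x}" "y \<in> r `` {x}"
      using assms by (auto simp: equiv_def refl_on_def)
    then show "(x, y) \<in> (\<Union>A\<in>X // r. A \<times> A)"
      using quotientI by fast
  qed
qed

text \<open>Translates the case distinction in \<open>partition_otimes2\<close> into whether
  \<open>d\<close> vanishes identically. For empty \<open>X\<close> the quotient would have no class
  at all.\<close>

lemma card_quotient_eq_1_iff:
  assumes "equiv X r" "X \<noteq> {}"
  shows "card (X // r) = 1 \<longleftrightarrow> r = X \<times> X"
proof
  assume "card (X // r) = 1"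
  then obtain A where A: "X // r = {A}" by (auto simp: card_1_singleton_iff)
  then have "A = X" using Union_quotient[OF assms(1)] by simp
  then show "r = X \<times> X" using A Union_squares_quotient[OF assms(1)] by simp
next
  assume "r = X \<times> X"
  then have "X // r = {X}" using assms(2) by (auto simp: quotient_def)
  then show "card (X // r) = 1" by simp
qed

lemma partition_otimes2_quotient_eq_dist_fibres:
  assumes "X \<noteq> {}" "pseudometric_on X d"
    and "finite (dist_values X d)" "card (dist_values X d) \<le> 2"
  shows "partition_otimes2 X (X // zero_dist_rel X d) = dist_fibres X d"
proof -
  let ?r = "zero_dist_rel X d"
  let ?F = "\<lambda>t. {(x, y). x \<in> X \<and> y \<in> X \<and> d x y = t}"
  note eqv = equiv_zero_dist_rel[OF assms(2)]
  have F0: "?F 0 = ?r" by (simp add: zero_dist_rel_def)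
  show ?thesis
  proof (cases "?r = X \<times> X")
    case True
    then have "dist_values X d \<subseteq> {0}"
      by (auto simp: dist_values_def zero_dist_rel_def)
    then have "dist_values X d = {0}"
      using zero_in_dist_values[OF assms(1,2)] by blast
    then have "dist_fibres X d = {X \<times> X}"
      using F0 True by (simp add: dist_fibres_def)
    then show ?thesis
      using card_quotient_eq_1_iff[OF eqv assms(1)] True by (simp add: partition_otimes2_def)
  next
    case False
    then obtain x y where xy: "x \<in> X" "y \<in> X" "d x y \<noteq> 0"
      by (auto simp: zero_dist_rel_def)
    define t where "t = d x y"
    have "{0, t} \<subseteq> dist_values X d"
      using zero_in_dist_values[OF assms(1,2)] xy by (auto simp: dist_values_def t_def)
    \<comment> \<open>Two distinct values already exhaust the bound, so the inclusion is an
      equality.\<close>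
    moreover have "card {0, t} = 2" using xy by (simp add: t_def)
    ultimately have vals: "dist_values X d = {0, t}"
      using card_seteq[OF assms(3)] assms(4) by metis
    have dt: "d a b = 0 \<or> d a b = t" if "a \<in> X" "b \<in> X" for a b
      using that vals by (auto simp: dist_values_def)
    have "?F t = X \<times> X - ?r"
      using dt xy(3) by (auto simp: zero_dist_rel_def t_def)
    then have "dist_fibres X d = {?r, X \<times> X - ?r}"
      using vals F0 by (simp add: dist_fibres_def)
    then show ?thesis
      using card_quotient_eq_1_iff[OF eqv assms(1)] False Union_squares_quotient[OF eqv]
      by (simp add: partition_otimes2_def)
  qed
qed

theorem theorem5p4:
  fixes X :: "'a set" and d :: "'a \<Rightarrow> 'a \<Rightarrow> real"
  assumes "X \<noteq> {}" and "pseudometric_on X d"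
  shows "(discrete_pseudometric_on X d \<longleftrightarrow>
           partition_otimes2 X (X // zero_dist_rel X d) = dist_fibres X d) \<and>
         (partition_otimes2 X (X // zero_dist_rel X d) = dist_fibres X d \<longleftrightarrow>
           (\<exists>Q. partition_on X Q \<and> partition_otimes2 X Q = dist_fibres X d))"
proof -
  have "partition_otimes2 X (X // zero_dist_rel X d) = dist_fibres X d"
    if "discrete_pseudometric_on X d"
    using that partition_otimes2_quotient_eq_dist_fibres[OF assms]
      discrete_pseudometric_on_iff_card[OF assms(2)] by blast
  moreover have "partition_on X (X // zero_dist_rel X d)"
    by (rule partition_on_quotient[OF equiv_zero_dist_rel[OF assms(2)]])
  \<comment> \<open>The bound of two passes from \<open>partition_otimes2 X Q\<close> to the fibres
    and then to the values. Taking the quotient for \<open>Q\<close> gives the implication from (ii)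
    to (i), and an arbitrary partition the one from (iii) to (i).\<close>
  moreover have "discrete_pseudometric_on X d"
    if "partition_otimes2 X Q = dist_fibres X d" for Q
    using finite_partition_otimes2[of X Q] card_partition_otimes2_le[of X Q]
    unfolding that finite_dist_fibres_iff card_dist_fibres
      discrete_pseudometric_on_iff_card[OF assms(2)] by blast
  ultimately show ?thesis by blast
qed

end
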